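(* Let $r \geq 2$ and let $v = v_1 v_2 \cdots v_{|v|}$ be an element of the Young–Fibonacci lattice $\mathbb{YF}$ of rank $r$. Then $v$ is an Eeta win if and only if one of the following holds: (i) the prefix $v_{1:|v|-1} = v_1 v_2 \cdots v_{|v|-1}$ consists only of $1$s (it may be empty) and the total number of $1$s in $v$ is even; or (ii) the prefix $v_{1:|v|-1}$ does not consist only of $1$s, and the number of $1$s to the left of the leftmost $2$ in $v$ is odd.
   Context: Ungar game. Let $L$ be a finite meet-semilattice with minimum $\hat 0$. An Ungar move from $v \in L$ sends $v$ to the meet $\bigwedge(\{v\}\cup T)$, where $T$ is a subset of the set of elements covered by $v$; the move is nontrivial if $T \neq \emptyset$. The Ungar game starting at $v$ is played on the interval $[\hat 0, v]$: two players, Atniss (who moves first) and Eeta, alternately make nontrivial Ungar moves from the current element; the player who cannot make a nontrivial Ungar move loses. The element $v$ is an Atniss win if Atniss has a winning strategy in this game, and an Eeta win otherwise. (Equivalently: $v$ is an Eeta win iff every element reachable from $v$ by a nontrivial Ungar move is an Atniss win.) Young–Fibonacci lattice. The elements of $\mathbb{YF}$ are all finite words (including the empty word) over the alphabet $\{1,2\}$. The rank of $v = v_1\cdots v_{|v|}$ is $\rho(v)=\sum_{i=1}^{|v|} v_i$. For words $u,v$, $v$ covers $u$ if and only if either $v = u_{1:i}\,1\,u_{i+1:|u|}$ for some $i$ such that $u_{1:i}$ contains no $1$s, or $v = u_{1:i-1}\,2\,u_{i+1:|u|}$ where $u_i$ is the leftmost $1$ in $u$. Here $u_{i:j}=u_iu_{i+1}\cdots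 u_j$, and $u_{i:j}$ is the empty word if $i>j$. The partial order is the transitive-reflexive closure of this covering relation; $\mathbb{YF}$ is a lattice. *)

theory Defs
  imports "HOL-Algebra.Lattice"
begin

section \<open>Games in which a player who cannot move loses\<close>

text \<open>
  Positions are elements of \<^typ>\<open>'a\<close>, and \<open>R x y\<close> says that either player may move from \<open>x\<close> to
  \<open>y\<close>. A play is recorded as the nonempty list of the positions visited so far, so it is the first
  player's turn exactly when the length is odd. A strategy of the first player maps the play so far
  to the next position.
\<close>

definition play_from :: "('a \<Rightarrow> 'a \<Rightarrow> bool) \<Rightarrow> 'a \<Rightarrow> 'a list \<Rightarrow> bool" where
  "play_from R x p \<longleftrightarrow> p \<noteq> [] \<and> hd p = x \<and> successively R p"

definition follows_strategy :: "('a list \<Rightarrow> 'a) \<Rightarrow> 'a list \<Rightarrow> bool" where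
  "follows_strategy \<sigma> p \<longleftrightarrow>
     (\<forall>i. even i \<and> Suc i < length p \<longrightarrow> p ! Suc i = \<sigma> (take (Suc i) p))"

text \<open>
  A strategy is winning if, as long as the first player follows it, she is never without a legal
  move when it is her turn. The definition is meant for games without infinite plays (Ungar moves
  strictly decrease the position within a finite interval): there it means that the player who gets
  stuck is always the second one.
\<close>

definition winning_strategy :: "('a \<Rightarrow> 'a \<Rightarrow> bool) \<Rightarrow> 'a \<Rightarrow> ('a list \<Rightarrow> 'a) \<Rightarrow> bool" where
  "winning_strategy R x \<sigma> \<longleftrightarrow>
     (\<forall>p. play_from R x p \<and> follows_strategy \<sigma> p \<and> odd (length p) \<longrightarrow> R (last p) (\<sigma> p))"

lemma ex_winning_strategy_iff:
  "(\<exists>\<sigma>. winning_strategy R x \<sigma>) \<longleftrightarrow>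
     (\<exists>y. R x y \<and> (\<forall>z. R y z \<longrightarrow> (\<exists>\<sigma>. winning_strategy R z \<sigma>)))"
proof
  assume "\<exists>\<sigma>. winning_strategy R x \<sigma>"
  then obtain \<sigma> where w: "winning_strategy R x \<sigma>" ..
  define y where "y = \<sigma> [x]"
  have "R x y"
    using w[unfolded winning_strategy_def, rule_format, of "[x]"]
    by (auto simp: play_from_def follows_strategy_def y_def)
  moreover have "winning_strategy R z (\<lambda>p. \<sigma> (x # y # p))" if "R y z" for z
    unfolding winning_strategy_def
  proof (intro allI impI, elim conjE)
    fix p
    assume p: "play_from R z p" "follows_strategy (\<lambda>p. \<sigma> (x # y # p)) p" "odd (length p)"
    obtain q where q: "p = z # q"
      using p(1) by (cases p) (auto simp: play_from_def)
    have "play_from R x (x # y # p)"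
      using p(1) \<open>R x y\<close> that by (auto simp: play_from_def q)
    moreover have "follows_strategy \<sigma> (x # y # p)"
      unfolding follows_strategy_def
    proof (intro allI impI, elim conjE)
      fix i
      assume i: "even i" "Suc i < length (x # y # p)"
      show "(x # y # p) ! Suc i = \<sigma> (take (Suc i) (x # y # p))"
      proof (cases "i = 0")
        case False
        then obtain j where j: "i = Suc (Suc j)" using i(1) by (metis even_Suc even_zero not0_implies_Suc)
        then show ?thesis
          using p(2)[unfolded follows_strategy_def, rule_format, of j] i by simp
      qed (simp add: y_def)
    qed
    ultimately show "R (last p) (\<sigma> (x # y # p))"
      using w[unfolded winning_strategy_def, rule_format, of "x # y # p"] p(3) q by auto
  qed
  ultimately show "\<exists>y. R x y \<and> (\<forall>z. R y z \<longrightarrow> (\<exists>\<sigma>. winning_strategy R z \<sigma>))" by blast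
next
  assume "\<exists>y. R x y \<and> (\<forall>z. R y z \<longrightarrow> (\<exists>\<sigma>. winning_strategy R z \<sigma>))"
  then obtain y \<tau> where y: "R x y" and \<tau>: "\<And>z. R y z \<Longrightarrow> winning_strategy R z (\<tau> z)" by metis
  define \<sigma> where
    "\<sigma> p = (if length p < 2 then y else \<tau> (hd (drop 2 p)) (drop 2 p))" for p
  have "winning_strategy R x \<sigma>"
    unfolding winning_strategy_def
  proof (intro allI impI, elim conjE)
    fix p
    assume p: "play_from R x p" "follows_strategy \<sigma> p" "odd (length p)"
    show "R (last p) (\<sigma> p)"
    proof (cases "length p < 2")
      case True
      then have "p = [x]" using p(1) by (cases p) (auto simp: play_from_def)
      then show ?thesis using y by (simp add: \<sigma>_def)
    next
      case False
      then obtain a z q where q: "p = x # a # z # q"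
        using p(1,3) by (cases p; cases "tl p"; cases "tl (tl p)") (auto simp: play_from_def)
      have a: "a = y"
        using p(2)[unfolded follows_strategy_def, rule_format, of 0] by (simp add: q \<sigma>_def)
      have "play_from R z (z # q)" "R y z"
        using p(1) by (auto simp: play_from_def q a)
      moreover have "follows_strategy (\<tau> z) (z # q)"
        unfolding follows_strategy_def
      proof (intro allI impI, elim conjE)
        fix i
        assume "even i" "Suc i < length (z # q)"
        then show "(z # q) ! Suc i = \<tau> z (take (Suc i) (z # q))"
          using p(2)[unfolded follows_strategy_def, rule_format, of "Suc (Suc i)"]
          by (simp add: q \<sigma>_def)
      qed
      ultimately show ?thesis
        using \<tau>[of z, unfolded winning_strategy_def, rule_format, of "z # q"] p(3)
        by (simp add: q \<sigma>_def)
    qed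
  qed
  then show "\<exists>\<sigma>. winning_strategy R x \<sigma>" by blast
qed


section \<open>The Ungar game\<close>

definition covers :: "('a, 'b) gorder_scheme \<Rightarrow> 'a \<Rightarrow> 'a \<Rightarrow> bool" where
  "covers L y x \<longleftrightarrow> x \<in> carrier L \<and> y \<in> carrier L \<and> x \<sqsubset>\<^bsub>L\<^esub> y \<and>
     \<not> (\<exists>z\<in>carrier L. x \<sqsubset>\<^bsub>L\<^esub> z \<and> z \<sqsubset>\<^bsub>L\<^esub> y)"

definition nontrivial_ungar_move :: "('a, 'b) gorder_scheme \<Rightarrow> 'a \<Rightarrow> 'a \<Rightarrow> bool" where
  "nontrivial_ungar_move L x y \<longleftrightarrow>
     x \<in> carrier L \<and> (\<exists>T. T \<subseteq> {u. covers L x u} \<and> T \<noteq> {} \<and> y = \<Sqinter>\<^bsub>L\<^esub> ({x} \<union> T))"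

text \<open>
  Only the interval from the minimum to \<open>v\<close> matters for the game started at \<open>v\<close>, so \<open>L\<close> itself may
  be infinite.
\<close>

definition lower_interval :: "('a, 'b) gorder_scheme \<Rightarrow> 'a \<Rightarrow> ('a, 'b) gorder_scheme" where
  "lower_interval L v = L\<lparr>carrier := \<lbrace>\<bottom>\<^bsub>L\<^esub>..v\<rbrace>\<^bsub>L\<^esub>\<rparr>"

definition Atniss_win :: "('a, 'b) gorder_scheme \<Rightarrow> 'a \<Rightarrow> bool" where
  "Atniss_win L v \<longleftrightarrow> (\<exists>\<sigma>. winning_strategy (nontrivial_ungar_move (lower_interval L v)) v \<sigma>)"

definition Eeta_win :: "('a, 'b) gorder_scheme \<Rightarrow> 'a \<Rightarrow> bool" where
  "Eeta_win L v \<longleftrightarrow> \<not> Atniss_win L v"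


section \<open>The Young--Fibonacci lattice\<close>

text \<open>
  \<open>yf_covers v u\<close>: the word \<open>v\<close> arises from \<open>u\<close> by inserting a \<open>1\<close> that has no \<open>1\<close> to its left in
  \<open>u\<close>, or by changing the leftmost \<open>1\<close> of \<open>u\<close> into a \<open>2\<close>.
\<close>

definition yf_covers :: "nat list \<Rightarrow> nat list \<Rightarrow> bool" where
  "yf_covers v u \<longleftrightarrow>
     (\<exists>a b. u = a @ b \<and> 1 \<notin> set a \<and> v = a @ [1] @ b) \<or>
     (\<exists>a b. u = a @ [1] @ b \<and> 1 \<notin> set a \<and> v = a @ [2] @ b)"

definition YF :: "nat list gorder" where
  "YF = \<lparr>carrier = lists {1, 2}, eq = (=), le = (\<lambda>u v. yf_covers v u)\<^sup>*\<^sup>*\<rparr>"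

definition yf_rank :: "nat list \<Rightarrow> nat" where
  "yf_rank v = sum_list v"

lemma YF_simps [simp]:
  "carrier YF = lists {1, 2}"
  "u .=\<^bsub>YF\<^esub> v \<longleftrightarrow> u = v"
  "u \<sqsubseteq>\<^bsub>YF\<^esub> v \<longleftrightarrow> (\<lambda>u v. yf_covers v u)\<^sup>*\<^sup>* u v"
  by (simp_all add: YF_def)

lemma yf_covers_rank: "yf_covers v u \<Longrightarrow> yf_rank v = Suc (yf_rank u)"
  by (auto simp: yf_covers_def yf_rank_def)

lemma yf_le_rank:
  assumes "u \<sqsubseteq>\<^bsub>YF\<^esub> v"
  shows "u = v \<or> yf_rank u < yf_rank v"
proof -
  have "(\<lambda>u v. yf_covers v u)\<^sup>*\<^sup>* u v" using assms by simp
  then show ?thesis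
    by (induction rule: rtranclp_induct) (auto dest: yf_covers_rank)
qed

lemma YF_partial_order: "partial_order YF"
proof
  show "x .=\<^bsub>YF\<^esub> y" if "x \<sqsubseteq>\<^bsub>YF\<^esub> y" "y \<sqsubseteq>\<^bsub>YF\<^esub> x" for x y
    using yf_le_rank[OF that(1)] yf_le_rank[OF that(2)] by auto
qed (auto simp: YF_def)

lemma yf_covers_iff:
  assumes "u \<in> carrier YF" "v \<in> carrier YF"
  shows "covers YF v u \<longleftrightarrow> yf_covers v u"
proof
  assume c: "covers YF v u"
  then have uv: "(\<lambda>u v. yf_covers v u)\<^sup>*\<^sup>* u v" "u \<noteq> v"
    by (auto simp: covers_def lless_def)
  obtain w where w: "yf_covers w u" "(\<lambda>u v. yf_covers v u)\<^sup>*\<^sup>* w v"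
    using uv by (cases rule: converse_rtranclpE) auto
  have "w \<in> carrier YF"
    using w(1) assms(1) by (auto simp: yf_covers_def)
  moreover have "u \<noteq> w" using yf_covers_rank[OF w(1)] by auto
  ultimately have "w = v"
    using c w by (auto simp: covers_def lless_def)
  then show "yf_covers v u" using w(1) by simp
next
  assume v: "yf_covers v u"
  have "\<not> (\<exists>z\<in>carrier YF. u \<sqsubset>\<^bsub>YF\<^esub> z \<and> z \<sqsubset>\<^bsub>YF\<^esub> v)"
  proof safe
    fix z
    assume "u \<sqsubset>\<^bsub>YF\<^esub> z" "z \<sqsubset>\<^bsub>YF\<^esub> v"
    then have "yf_rank u < yf_rank z" "yf_rank z < yf_rank v"
      using yf_le_rank unfolding lless_def YF_simps(2) by blast+
    then show False using yf_covers_rank[OF v] by simp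
  qed
  moreover have "u \<noteq> v" using yf_covers_rank[OF v] by auto
  ultimately show "covers YF v u"
    using v assms by (auto simp: covers_def lless_def)
qed

end

theory Submission
  imports Defs
begin

text \<open>
  The words covered by \<open>2w\<close> are exactly the words covering \<open>w\<close>, and two distinct covers of \<open>w\<close> have
  meet \<open>w\<close>. So the only Ungar move from \<open>1w\<close> leads to \<open>w\<close>, while from \<open>2w\<close> with \<open>w\<close> nonempty one can
  move to \<open>w\<close> or to any cover of \<open>w\<close>, in particular to \<open>1w\<close>. Since \<open>1w\<close> is lost for the player to
  move iff \<open>w\<close> is won, one of \<open>w\<close>, \<open>1w\<close> is a losing position, and every such \<open>2w\<close> is a win for
  Atniss. Each leading \<open>1\<close> then flips the winner.
\<close>

declare One_nat_def [simp del]

section \<open>The covering relation letter by letter\<close>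

abbreviation yf_le :: "nat list \<Rightarrow> nat list \<Rightarrow> bool" where
  "yf_le \<equiv> (\<lambda>u v. yf_covers v u)\<^sup>*\<^sup>*"

text \<open>Either the prefix \<open>a\<close> in front of the inserted or changed letter is empty,
  which gives the first two cases, or its head, a letter other than 1, is stripped from both
  words.\<close>

lemma yf_covers_cases:
  assumes "yf_covers v u"
  obtains "v = 1 # u" | b where "u = 1 # b" "v = 2 # b"
  | c u' v' where "u = c # u'" "v = c # v'" "c \<noteq> 1" "yf_covers v' u'"
proof -
  consider a b where "u = a @ b" "1 \<notin> set a" "v = a @ [1] @ b"
    | a b where "u = a @ [1] @ b" "1 \<notin> set a" "v = a @ [2] @ b"
    using assms unfolding yf_covers_def by blast
  then show thesis
  proof cases
    case (1 a b)
    show thesis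
    proof (cases a)
      case Nil
      then show thesis using 1 that(1) by simp
    next
      case (Cons c a')
      have "yf_covers (a' @ [1] @ b) (a' @ b)"
        using 1 Cons unfolding yf_covers_def by auto
      then show thesis using 1 Cons that(3) by simp
    qed
  next
    case (2 a b)
    show thesis
    proof (cases a)
      case Nil
      then show thesis using 2 that(2) by simp
    next
      case (Cons c a')
      have "yf_covers (a' @ [2] @ b) (a' @ [1] @ b)"
        using 2 Cons unfolding yf_covers_def by auto
      then show thesis using 2 Cons that(3) by simp
    qed
  qed
qed

lemma yf_covers_insert1: "yf_covers (1 # u) u"
  unfolding yf_covers_def by (rule disjI1, rule exI[of _ "[]"]) simp

lemma yf_covers_change1: "yf_covers (2 # b) (1 # b)"
  unfolding yf_covers_def by (rule disjI2, rule exI[of _ "[]"]) simp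

lemma yf_covers_Cons:
  assumes "c \<noteq> 1" "yf_covers v u"
  shows "yf_covers (c # v) (c # u)"
proof -
  consider a b where "u = a @ b" "1 \<notin> set a" "v = a @ [1] @ b"
    | a b where "u = a @ [1] @ b" "1 \<notin> set a" "v = a @ [2] @ b"
    using assms(2) unfolding yf_covers_def by blast
  then show ?thesis
  proof cases
    case (1 a b)
    then show ?thesis
      using assms(1) unfolding yf_covers_def by (intro disjI1 exI[of _ "c # a"] exI[of _ b]) auto
  next
    case (2 a b)
    then show ?thesis
      using assms(1) unfolding yf_covers_def by (intro disjI2 exI[of _ "c # a"] exI[of _ b]) auto
  qed
qed

lemma yf_covers_Cons1_iff: "yf_covers (1 # w) u \<longleftrightarrow> u = w"
  using yf_covers_insert1 by (auto elim: yf_covers_cases)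

lemma yf_covers_Cons2_iff:
  "yf_covers (2 # w) x \<longleftrightarrow> x = 1 # w \<or> (\<exists>u. x = 2 # u \<and> yf_covers w u)"
  using yf_covers_change1 yf_covers_Cons[of 2] by (auto elim: yf_covers_cases)

lemma not_yf_covers_Nil: "\<not> yf_covers [] u"
  by (simp add: yf_covers_def)

lemma covers_yf_Nil_iff: "yf_covers x [] \<longleftrightarrow> x = [1]"
  using yf_covers_insert1[of "[]"] by (auto elim: yf_covers_cases)

lemma covers_yf_Cons1_iff: "yf_covers x (1 # b) \<longleftrightarrow> x = 1 # 1 # b \<or> x = 2 # b"
  using yf_covers_insert1 yf_covers_change1 by (auto elim: yf_covers_cases)

lemma covers_yf_Cons2_iff:
  "yf_covers x (2 # b) \<longleftrightarrow> x = 1 # 2 # b \<or> (\<exists>y. x = 2 # y \<and> yf_covers y b)"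
  using yf_covers_insert1 yf_covers_Cons[of 2] by (auto elim: yf_covers_cases)

text \<open>Induction on \<open>w\<close>: for \<open>1 # b\<close> both sides hold exactly for
  \<open>1 # 1 # b\<close> and \<open>2 # b\<close>; for \<open>2 # b\<close> they hold for
  \<open>1 # 2 # b\<close> and for the words \<open>2 # y\<close> with \<open>y\<close> covering
  \<open>b\<close>, where the induction hypothesis matches the two descriptions.\<close>

lemma yf_covers_Cons2_iff_covers:
  assumes "w \<in> lists {1, 2}"
  shows "yf_covers (2 # w) x \<longleftrightarrow> yf_covers x w"
  using assms
proof (induction w arbitrary: x)
  case Nil
  then show ?case by (simp add: yf_covers_Cons2_iff covers_yf_Nil_iff not_yf_covers_Nil)
next
  case (Cons c w)
  then consider "c = 1" | "c = 2" by auto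
  then show ?case
  proof cases
    case 1
    then show ?thesis
      by (auto simp: yf_covers_Cons2_iff covers_yf_Cons1_iff yf_covers_Cons1_iff)
  next
    case 2
    then show ?thesis
      using Cons by (auto simp: yf_covers_Cons2_iff[of "2 # w"] covers_yf_Cons2_iff)
  qed
qed

section \<open>The order and its behaviour under removal of the first letter\<close>

lemma yf_le_cases:
  assumes "yf_le z v"
  obtains "z = v" | u where "yf_covers v u" "yf_le z u"
  using assms by (cases rule: rtranclp.cases) auto

lemma yf_covers_imp_le: "yf_covers v u \<Longrightarrow> yf_le u v"
  by (rule r_into_rtranclp)

lemma yf_covers_lists:
  "yf_covers v u \<Longrightarrow> v \<in> lists {1, 2} \<longleftrightarrow> u \<in> lists {1, 2}"
  by (auto simp: yf_covers_def)

lemma yf_le_lists: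
  assumes "yf_le u v" "v \<in> lists {1, 2}"
  shows "u \<in> lists {1, 2}"
  using assms by (induction rule: rtranclp_induct) (auto simp: yf_covers_lists)

lemma yf_le_Cons1: "yf_le u (1 # u)"
  by (rule yf_covers_imp_le[OF yf_covers_insert1])

lemma yf_le_Cons1_Cons2: "yf_le (1 # u) (2 # u)"
  by (rule yf_covers_imp_le[OF yf_covers_change1])

lemma yf_le_Cons2: "yf_le u v \<Longrightarrow> yf_le (2 # u) (2 # v)"
proof (induction rule: rtranclp_induct)
  case (step y z)
  then show ?case
    using yf_covers_imp_le[OF yf_covers_Cons[of 2 z y]] by (auto intro: rtranclp_trans)
qed simp

lemma yf_le_tail: "c \<in> {1, 2} \<Longrightarrow> yf_le z (c # z)"
  using yf_le_Cons1[of z] yf_le_Cons1_Cons2[of z] by (auto intro: rtranclp_trans)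

text \<open>Follow a chain down from \<open>2 # w\<close>: its first step leads to
  \<open>1 # w\<close> or to some \<open>2 # x\<close> with \<open>x\<close> covered by
  \<open>w\<close>, where the induction on rank applies.\<close>

lemma yf_le_Cons2D: "yf_le (c # z) (2 # w) \<Longrightarrow> w \<in> lists {1, 2} \<Longrightarrow> yf_le z w"
proof (induction "yf_rank w" arbitrary: w rule: less_induct)
  case less
  show ?case
    using less.prems(1)
  proof (cases rule: yf_le_cases)
    case (2 u)
    then consider "u = 1 # w" | x where "u = 2 # x" "yf_covers w x"
      by (auto simp: yf_covers_Cons2_iff)
    then show ?thesis
    proof cases
      case 1
      from \<open>yf_le (c # z) u\<close> show ?thesis
      proof (cases rule: yf_le_cases)
        case 1
        then show ?thesis using \<open>u = 1 # w\<close> by simp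
      next
        case (2 u')
        \<comment> \<open>The word \<open>1 # w\<close> covers only \<open>w\<close>, so the chain
          passes through \<open>w\<close>; dropping \<open>c\<close> leads further down.\<close>
        then have "yf_le (c # z) w" using \<open>u = 1 # w\<close> by (simp add: yf_covers_Cons1_iff)
        moreover from this have "c \<in> {1, 2}"
          using less.prems(2) yf_le_lists by fastforce
        ultimately show ?thesis
          using yf_le_tail rtranclp_trans[of _ z "c # z" w] by blast
      qed
    next
      case (2 x)
      then have "yf_le z x"
        using less \<open>yf_le (c # z) u\<close> yf_covers_lists yf_covers_rank
        by (metis lessI)
      then show ?thesis
        using 2 by (metis rtranclp.rtrancl_into_rtrancl)
    qed
  qed auto
qed

lemma yf_le_Cons_Cons2: "c \<in> {1, 2} \<Longrightarrow> yf_le z w \<Longrightarrow> yf_le (c # z) (2 # w)"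
  using yf_le_Cons2[of z w] yf_le_Cons1_Cons2[of z] by (auto intro: rtranclp_trans)

lemma yf_Nil_le: "v \<in> lists {1, 2} \<Longrightarrow> yf_le [] v"
  by (induction v) (auto intro: rtranclp_trans yf_le_tail)

lemma yf_le_Cons1_iff: "yf_le z (1 # w) \<longleftrightarrow> z = 1 # w \<or> yf_le z w"
  by (auto simp: yf_covers_Cons1_iff intro: rtranclp_trans yf_le_Cons1 elim: yf_le_cases)

section \<open>Meets of two covers of a word\<close>

text \<open>A word below \<open>1 # w\<close> is \<open>1 # w\<close> itself or already below
  \<open>w\<close>. The former cannot lie below \<open>x\<close>, a different word of the same
  rank.\<close>

lemma yf_le_Cons1_common_lower:
  assumes "yf_covers x w" "x \<noteq> 1 # w" "yf_le z x" "yf_le z (1 # w)"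
  shows "yf_le z w"
proof -
  have "z \<noteq> 1 # w"
    using yf_le_rank[of z x] yf_covers_rank[OF assms(1)] assms(2,3) by (auto simp: yf_rank_def)
  then show ?thesis using assms(4) by (simp add: yf_le_Cons1_iff)
qed

text \<open>As \<open>w\<close> lies below both covers, this makes \<open>w\<close> their meet. If
  one of them is \<open>1 # w\<close>, the previous lemma applies; otherwise both covers and
  \<open>w\<close> begin with 2, and stripping the heads reduces the claim to a shorter
  word.\<close>

lemma yf_le_common_lower:
  assumes "w \<in> lists {1, 2}" "yf_covers x w" "yf_covers y w" "x \<noteq> y" "yf_le z x" "yf_le z y"
  shows "yf_le z w"
  using assms
proof (induction w arbitrary: x y z rule: list.induct)
  case Nil
  then show ?case by (simp add: covers_yf_Nil_iff)
next
  case (Cons c w)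
  show ?case
  proof (cases "x = 1 # c # w \<or> y = 1 # c # w")
    case True
    then show ?thesis
      using yf_le_Cons1_common_lower[of x "c # w" z] yf_le_Cons1_common_lower[of y "c # w" z]
        Cons.prems by auto
  next
    case False
    \<comment> \<open>Besides \<open>1 # 1 # w\<close>, the word \<open>1 # w\<close> has the single
      cover \<open>2 # w\<close>, so \<open>x\<close> and \<open>y\<close> would coincide.\<close>
    have "c \<noteq> 1"
    proof
      assume c: "c = 1"
      have "x = 2 # w" "y = 2 # w"
        using Cons.prems(2,3) False unfolding c covers_yf_Cons1_iff by simp_all
      then show False using Cons.prems(4) by simp
    qed
    with Cons.prems(1) have c: "c = 2" by auto
    with Cons.prems(2,3) False obtain x' y'
      where x': "x = 2 # x'" "yf_covers x' w" and y': "y = 2 # y'" "yf_covers y' w"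
      by (auto simp: covers_yf_Cons2_iff)
    have l: "w \<in> lists {1, 2}" "x' \<in> lists {1, 2}" "y' \<in> lists {1, 2}"
      using Cons.prems(1) yf_covers_lists x'(2) y'(2) by auto
    show ?thesis
    proof (cases z)
      case Nil
      then show ?thesis using yf_Nil_le[OF Cons.prems(1)] by simp
    next
      case z: (Cons d z')
      have "yf_le z' x'" "yf_le z' y'"
        using Cons.prems(5,6) x'(1) y'(1) z l(2,3) yf_le_Cons2D by simp_all
      moreover have "x' \<noteq> y'" using Cons.prems(4) x'(1) y'(1) by simp
      ultimately have "yf_le z' w" using Cons.IH l(1) x'(2) y'(2) by simp
      moreover have "z \<in> lists {1, 2}"
        using Cons.prems(5) x'(1) l(2) yf_le_lists[of z x] by auto
      ultimately show ?thesis using z c yf_le_Cons_Cons2 by simp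
    qed
  qed
qed

section \<open>Ungar moves in terms of words\<close>

text \<open>The first disjunct comes from a singleton \<open>T\<close>, the second from a
  \<open>T\<close> with at least two elements. The condition on \<open>w\<close> reflects that
  \<open>[2]\<close> covers \<open>[1]\<close> alone.\<close>

definition yf_move :: "nat list \<Rightarrow> nat list \<Rightarrow> bool" where
  "yf_move x y \<longleftrightarrow> yf_covers x y \<or> (\<exists>w. w \<noteq> [] \<and> x = 2 # w \<and> y = w)"

lemma bottom_YF: "\<bottom>\<^bsub>YF\<^esub> = []"
proof -
  have "least YF [] (carrier YF)"
    by (auto simp: least_def intro: yf_Nil_le)
  then show ?thesis
    unfolding bottom_def using partial_order.least_unique[OF YF_partial_order]
    by (intro some_equality)
qed

lemma lower_interval_YF_simps:
  assumes "v \<in> lists {1, 2}"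
  shows "carrier (lower_interval YF v) = {u. yf_le u v}"
    and "u \<sqsubseteq>\<^bsub>lower_interval YF v\<^esub> w \<longleftrightarrow> yf_le u w"
    and "u .=\<^bsub>lower_interval YF v\<^esub> w \<longleftrightarrow> u = w"
  using yf_le_lists[OF _ assms] yf_Nil_le
  by (auto simp: lower_interval_def at_least_at_most_def bottom_YF)

text \<open>The interval contains everything below \<open>x\<close>, so restricting the carrier
  loses neither a candidate \<open>u\<close> nor a word between \<open>u\<close> and
  \<open>x\<close>.\<close>

lemma covers_lower_interval_YF_iff:
  assumes "v \<in> lists {1, 2}" "yf_le x v"
  shows "covers (lower_interval YF v) x u \<longleftrightarrow> yf_covers x u"
proof -
  have "yf_le z v \<and> z \<in> lists {1, 2}" if "yf_le z x" for z
    using that assms yf_le_lists[of z v] rtranclp_trans[of _ z x v] by auto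
  then have "covers (lower_interval YF v) x u \<longleftrightarrow> covers YF x u"
    unfolding covers_def lless_def lower_interval_YF_simps[OF assms(1)] YF_simps Bex_def mem_Collect_eq
    using assms(2) yf_le_lists[OF _ assms(1)] by auto
  also have "\<dots> \<longleftrightarrow> yf_covers x u"
  proof (cases "u \<in> lists {1, 2}")
    case True
    then show ?thesis using yf_covers_iff[of u x] yf_le_lists[OF assms(2,1)] by simp
  next
    case False
    then show ?thesis
      using yf_covers_lists[of x u] yf_le_lists[OF assms(2,1)] by (auto simp: covers_def)
  qed
  finally show ?thesis .
qed

text \<open>The meet operator is a choice among greatest lower bounds, so \<open>m\<close> must be
  shown to be the only one; this is antisymmetry, obtained from ranks.\<close>

lemma inf_lower_interval_YF_eq:
  assumes "v \<in> lists {1, 2}" "\<And>a. a \<in> A \<Longrightarrow> yf_le a v" "yf_le m v"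
    and "\<And>a. a \<in> A \<Longrightarrow> yf_le m a"
    and "\<And>z. (\<And>a. a \<in> A \<Longrightarrow> yf_le z a) \<Longrightarrow> yf_le z m"
  shows "\<Sqinter>\<^bsub>lower_interval YF v\<^esub> A = m"
proof -
  have *: "yf_le a b \<Longrightarrow> yf_le b a \<Longrightarrow> a = b" for a b
    using yf_le_rank[of a b] yf_le_rank[of b a] by auto
  have "greatest (lower_interval YF v) m (Lower (lower_interval YF v) A)"
    unfolding greatest_def Lower_def lower_interval_YF_simps[OF assms(1)]
    using assms(2-5) by blast
  moreover have "g = m" if "greatest (lower_interval YF v) g (Lower (lower_interval YF v) A)" for g
    using calculation that unfolding greatest_def lower_interval_YF_simps[OF assms(1)]
    by (intro *) auto
  ultimately show ?thesis
    unfolding Lattice.inf_def by (rule some_equality)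
qed

text \<open>A singleton \<open>T\<close> has its element as the meet. If \<open>T\<close> has two
  distinct elements, \<open>x\<close> must be some \<open>2 # w\<close>, the elements of
  \<open>T\<close> are covers of \<open>w\<close>, and those two already meet in
  \<open>w\<close>.\<close>

lemma ungar_move_lower_interval_YF_iff:
  assumes v: "v \<in> lists {1, 2}" and x: "yf_le x v"
  shows "nontrivial_ungar_move (lower_interval YF v) x y \<longleftrightarrow> yf_move x y"
proof -
  let ?I = "lower_interval YF v"
  have xl: "x \<in> lists {1, 2}" using yf_le_lists[OF x v] .
  have iff: "nontrivial_ungar_move ?I x y \<longleftrightarrow>
      (\<exists>T. T \<subseteq> {u. yf_covers x u} \<and> T \<noteq> {} \<and> y = \<Sqinter>\<^bsub>?I\<^esub> ({x} \<union> T))"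
    unfolding nontrivial_ungar_move_def
    unfolding lower_interval_YF_simps[OF v] covers_lower_interval_YF_iff[OF v x] using x by simp
  have le: "yf_le a v" if "a \<in> {x} \<union> T" "T \<subseteq> {u. yf_covers x u}" for a T
    using that x by (auto intro: converse_rtranclp_into_rtranclp)
  have single: "\<Sqinter>\<^bsub>?I\<^esub> ({x} \<union> {u}) = u" if "yf_covers x u" for u
    using that le[of _ "{u}"] by (intro inf_lower_interval_YF_eq[OF v]) (auto intro: yf_covers_imp_le)
  have multi: "\<exists>w. x = 2 # w \<and> w \<noteq> [] \<and> \<Sqinter>\<^bsub>?I\<^esub> ({x} \<union> T) = w"
    if T: "T \<subseteq> {u. yf_covers x u}" "a \<in> T" "b \<in> T" "a \<noteq> b" for T a b
  proof -
    have ab: "yf_covers x a" "yf_covers x b" using T by auto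
    obtain c w where cw: "x = c # w"
      using ab(1) not_yf_covers_Nil by (cases x) auto
    have "c \<noteq> 1" using ab T(4) cw by (auto simp: yf_covers_Cons1_iff)
    then have x2: "x = 2 # w" and w: "w \<in> lists {1, 2}" using cw xl by auto
    then have cov: "yf_covers x u \<longleftrightarrow> yf_covers u w" for u
      by (simp add: yf_covers_Cons2_iff_covers)
    have "w \<noteq> []" using cov ab T(4) by (auto simp: covers_yf_Nil_iff)
    moreover have "\<Sqinter>\<^bsub>?I\<^esub> ({x} \<union> T) = w"
    proof (rule inf_lower_interval_YF_eq[OF v])
      have wx: "yf_le w x" using x2 yf_le_tail by simp
      then show "yf_le w v" using x by (rule rtranclp_trans)
      show "yf_le w a" if "a \<in> {x} \<union> T" for a
        using that T(1) wx cov yf_covers_imp_le by blast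
      show "yf_le z w" if "\<And>a. a \<in> {x} \<union> T \<Longrightarrow> yf_le z a" for z
        using yf_le_common_lower[OF w _ _ T(4)] ab cov that T by simp
    qed (use le T in blast)
    ultimately show ?thesis using x2 by blast
  qed
  show ?thesis
  proof
    assume "nontrivial_ungar_move ?I x y"
    then obtain T where T: "T \<subseteq> {u. yf_covers x u}" "T \<noteq> {}" "y = \<Sqinter>\<^bsub>?I\<^esub> ({x} \<union> T)"
      using iff by blast
    show "yf_move x y"
    proof (cases "\<exists>a\<in>T. \<exists>b\<in>T. a \<noteq> b")
      case True
      then show ?thesis using multi[OF T(1)] T(3) unfolding yf_move_def by blast
    next
      case False
      then obtain u where "T = {u}" using T(2) by blast
      then show ?thesis using T single unfolding yf_move_def by auto
    qed
  next
    assume "yf_move x y"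
    then consider "yf_covers x y" | w where "w \<noteq> []" "x = 2 # w" "y = w"
      unfolding yf_move_def by blast
    then show "nontrivial_ungar_move ?I x y"
    proof cases
      case 1
      then show ?thesis unfolding iff using single[of y] by (intro exI[of _ "{y}"]) auto
    next
      case 2
      then have cov: "yf_covers x u \<longleftrightarrow> yf_covers u w" for u
        using xl by (simp add: yf_covers_Cons2_iff_covers)
      obtain d w' where w': "w = d # w'" "d \<in> {1, 2}" using 2 xl by (cases w) auto
      \<comment> \<open>A cover of \<open>w\<close> other than \<open>1 # w\<close>, so that the two
        meet in \<open>w\<close>: a leading 1 of \<open>w\<close> becomes 2, while behind a leading
        2 a 1 is inserted.\<close>
      define b where "b = (if d = 1 then 2 # w' else 2 # 1 # w')"
      have "yf_covers b w" "1 # w \<noteq> b"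
        using w' by (auto simp: b_def covers_yf_Cons1_iff covers_yf_Cons2_iff yf_covers_insert1)
      then have "yf_covers x (1 # w)" "yf_covers x b" "1 # w \<noteq> b"
        using yf_covers_insert1 by (simp_all only: cov) simp
      then show ?thesis
        unfolding iff using multi[of "{1 # w, b}" "1 # w" b] 2
        by (intro exI[of _ "{1 # w, b}"]) auto
    qed
  qed
qed

section \<open>Winning positions and their recursion\<close>

text \<open>\<open>Atniss_win\<close> ties the interval to the starting position; the recursion has
  to vary the position within a fixed interval.\<close>

definition wins :: "('a \<Rightarrow> 'a \<Rightarrow> bool) \<Rightarrow> 'a \<Rightarrow> bool" where
  "wins R x \<longleftrightarrow> (\<exists>\<sigma>. winning_strategy R x \<sigma>)"

lemma wins_iff: "wins R x \<longleftrightarrow> (\<exists>y. R x y \<and> (\<forall>z. R y z \<longrightarrow> wins R z))"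
  unfolding wins_def by (rule ex_winning_strategy_iff)

text \<open>The induction hypothesis at \<open>y\<close> turns "every move from \<open>y\<close>
  leads to a win" into "\<open>y\<close> is not a win", so the recursion over two moves becomes one
  over a single move. The measure \<open>f\<close> excludes infinite plays, and the invariant
  \<open>P\<close> will be membership in the interval.\<close>

lemma wins_iff_not_wins:
  fixes f :: "'a \<Rightarrow> nat"
  assumes "P x"
    and closed: "\<And>x y. P x \<Longrightarrow> R x y \<Longrightarrow> P y"
    and decr: "\<And>x y. P x \<Longrightarrow> R x y \<Longrightarrow> f y < f x"
  shows "wins R x \<longleftrightarrow> (\<exists>y. R x y \<and> \<not> wins R y)"
  using assms(1)
proof (induction "f x" arbitrary: x rule: less_induct)
  case less
  have "\<not> wins R y \<longleftrightarrow> (\<forall>z. R y z \<longrightarrow> wins R z)" if "R x y" for y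
    using less.hyps[OF decr[OF less.prems that]] closed[OF less.prems that] by blast
  then show ?case using wins_iff[of R x] by blast
qed

lemma wins_ungar_iff:
  assumes v: "v \<in> lists {1, 2}" and x: "yf_le x v"
  defines "W \<equiv> wins (nontrivial_ungar_move (lower_interval YF v))"
  shows "W x \<longleftrightarrow> (\<exists>y. yf_move x y \<and> \<not> W y)"
proof -
  let ?R = "nontrivial_ungar_move (lower_interval YF v)"
  have le: "yf_le y x" if "yf_move x y" for x y
    using that yf_le_tail[of 2] yf_covers_imp_le unfolding yf_move_def by auto
  have rank: "yf_rank y < yf_rank x" if "yf_move x y" for x y
    using that yf_covers_rank unfolding yf_move_def yf_rank_def by fastforce
  have "W x \<longleftrightarrow> (\<exists>y. ?R x y \<and> \<not> W y)"
    unfolding W_def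
  proof (rule wins_iff_not_wins[of "\<lambda>x. yf_le x v" x ?R yf_rank, OF x])
    fix x y
    assume "yf_le x v" "?R x y"
    then have "yf_le x v" "yf_move x y" using ungar_move_lower_interval_YF_iff[OF v] by auto
    then show "yf_le y v" "yf_rank y < yf_rank x"
      using le rank rtranclp_trans[of _ y x v] by auto
  qed
  then show ?thesis using ungar_move_lower_interval_YF_iff[OF v x] by simp
qed

text \<open>The interval stays that of \<open>v\<close> while the induction strips letters from
  \<open>x\<close>, whose tails all remain below \<open>v\<close>.\<close>

lemma not_wins_ungar_iff:
  assumes v: "v \<in> lists {1, 2}" and x: "yf_le x v"
  defines "W \<equiv> wins (nontrivial_ungar_move (lower_interval YF v))"
  shows "\<not> W x \<longleftrightarrow>
    (set (butlast x) \<subseteq> {1} \<and> even (count_list x 1)) \<or>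
    (\<not> set (butlast x) \<subseteq> {1} \<and> odd (count_list (takeWhile (\<lambda>x. x \<noteq> 2) x) 1))"
proof -
  note W = wins_ungar_iff[OF v, folded W_def]
  show ?thesis
    using x
  proof (induction x)
    case Nil
    then show ?case using W by (simp add: yf_move_def not_yf_covers_Nil)
  next
    case (Cons c w)
    have cw: "c \<in> {1, 2}" "w \<in> lists {1, 2}"
      using yf_le_lists[OF Cons.prems v] by auto
    have w: "yf_le w v"
      using yf_le_tail[OF cw(1)] Cons.prems by (rule rtranclp_trans)
    from cw(1) consider "c = 1" | "c = 2" "w = []" | "c = 2" "w \<noteq> []" by auto
    then show ?case
    proof cases
      case 1
      \<comment> \<open>The move to \<open>w\<close> is forced, and a leading 1 flips the parity in
        both clauses.\<close>
      then have "W (c # w) \<longleftrightarrow> \<not> W w"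
        using W[OF Cons.prems] by (simp add: yf_move_def yf_covers_Cons1_iff)
      then show ?thesis using Cons.IH[OF w] 1 by (cases "w = []") auto
    next
      case 2
      then have "yf_le [1] v"
        using Cons.prems yf_le_Cons1_Cons2[of "[]"] by (auto intro: rtranclp_trans)
      \<comment> \<open>The forced move from \<open>[2]\<close> is to \<open>[1]\<close>, which wins
        by moving to \<open>[]\<close>.\<close>
      then have "W [1]"
        using W[of "[1]"] W[of "[]"] yf_Nil_le[OF v]
        by (simp add: yf_move_def yf_covers_Cons1_iff not_yf_covers_Nil)
      then show ?thesis
        using W[OF Cons.prems] 2
        by (simp add: yf_move_def yf_covers_Cons2_iff not_yf_covers_Nil)
    next
      case 3
      have "yf_le (1 # w) v"
        using 3 Cons.prems yf_le_Cons1_Cons2[of w] by (auto intro: rtranclp_trans)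
      then have "W (1 # w) \<longleftrightarrow> \<not> W w"
        using W by (simp add: yf_move_def yf_covers_Cons1_iff)
      \<comment> \<open>Both \<open>w\<close> and \<open>1 # w\<close> are within reach and exactly
        one of them is lost. No 1 precedes the leading 2, so the right-hand side is false.\<close>
      moreover have "yf_move (c # w) w" "yf_move (c # w) (1 # w)"
        using 3 yf_covers_change1 by (auto simp: yf_move_def)
      ultimately have "W (c # w)" using W[OF Cons.prems] by blast
      then show ?thesis using 3 by simp
    qed
  qed
qed

theorem theorem1p1:
  fixes r :: nat and v :: "nat list"
  assumes "r \<ge> 2" and "v \<in> carrier YF" and "yf_rank v = r"
  shows "Eeta_win YF v \<longleftrightarrow>
    (set (butlast v) \<subseteq> {1} \<and> even (count_list v 1)) \<or>
    (\<not> set (butlast v) \<subseteq> {1} \<and> odd (count_list (takeWhile (\<lambda>x. x \<noteq> 2) v) 1))"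
  using not_wins_ungar_iff[of v v] assms(2)
  unfolding Eeta_win_def Atniss_win_def wins_def by simp

end
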